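(* Let $G=(V,E)$ be a finite simple graph and let $g\in\{0,1,-1\}^E$ be a mixed-sign vector such that the edges in $\mathrm{supp}(g)$ form one of the following structures in $G$: (1) a pseudo-alternating path with at least $4$ subpaths $H_i$, all having length at least $2$; or (2) a pseudo-alternating cycle with at least $4$ subpaths $H_i$, where $|H_i|\ge 2$ for even $i$ and $|H_i|\ge 3$ for odd $i$. Then $g$ is a circuit of the rank inequality system of $G$.
   Context: A vector is mixed-sign if it has at least one positive and at least one negative entry. A $+$-edge (resp. $-$-edge) is an edge $e$ with $g(e)>0$ (resp. $g(e)<0$). A pseudo-alternating structure on a path or cycle $H$ with edge set $\mathrm{supp}(g)$ is a decomposition of $H$ into consecutive subpaths $(H_i)$ (consecutively, and for a cycle cyclically, arranged along $H$, with edge sets partitioning that of $H$) such that all edges of $H_i$ are $+$-edges for even $i$ and all edges of $H_i$ are $-$-edges for odd $i$, and the signs of consecutive subpaths alternate; i.e. contracting each subpath to a single edge of its sign gives an alternating path or an (even length) alternating cycle. The length $|H_i|$ is the number of edges of $H_i$. The rank inequality system of $G$ is $\sum_{e\in E(G[U])}x(e)\le |U|-1$ for all $\emptyset\neq U\subseteq V$, where $G[U]$ is the subgraph induced by $U$; let $B$ be its constraint matrix, so $(Bx)_U=\sum_{e\in E(G[U])}x(e)$. A circuit of the system is a vector $g\in\mathbb{R}^E\setminus\{0\}$ with coprime integer components such that the support of $Bg$ is inclusion-minimal among the supports of $\{Bx : x\in\mathbb{R}^E\setminus\{0\}\}$. *)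

theory Defs
  imports Complex_Main "HOL-Library.FuncSet"
begin

definition finite_simple_graph :: "'a set \<Rightarrow> 'a set set \<Rightarrow> bool" where
  "finite_simple_graph V E \<longleftrightarrow> finite V \<and> (\<forall>e\<in>E. e \<subseteq> V \<and> card e = 2)"

definition induced_edges :: "'a set set \<Rightarrow> 'a set \<Rightarrow> 'a set set" where
  "induced_edges E U = {e \<in> E. e \<subseteq> U}"

(* The space of real vectors indexed by J is J \<rightarrow>\<^sub>E UNIV: coordinates off J are undefined,
   so that equality of vectors is equality of their coordinates on J. *)

definition zero_vec :: "'j set \<Rightarrow> 'j \<Rightarrow> real" where
  "zero_vec J = (\<lambda>j\<in>J. 0)"

definition supp :: "'j set \<Rightarrow> ('j \<Rightarrow> real) \<Rightarrow> 'j set" where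
  "supp J x = {j \<in> J. x j \<noteq> 0}"

definition mixed_sign :: "'j set \<Rightarrow> ('j \<Rightarrow> real) \<Rightarrow> bool" where
  "mixed_sign J x \<longleftrightarrow> (\<exists>j\<in>J. x j > 0) \<and> (\<exists>j\<in>J. x j < 0)"

definition mat_vec :: "'i set \<Rightarrow> 'j set \<Rightarrow> ('i \<Rightarrow> 'j \<Rightarrow> real) \<Rightarrow> ('j \<Rightarrow> real) \<Rightarrow> 'i \<Rightarrow> real" where
  "mat_vec I J B x = (\<lambda>i\<in>I. \<Sum>j\<in>J. B i j * x j)"

definition coprime_integer_vec :: "'j set \<Rightarrow> ('j \<Rightarrow> real) \<Rightarrow> bool" where
  "coprime_integer_vec J x \<longleftrightarrow>
     (\<exists>z :: 'j \<Rightarrow> int. (\<forall>j\<in>J. x j = of_int (z j)) \<and> Gcd (z ` J) = 1)"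

(* Circuits of a system B x \<le> b, where B has rows I and columns J; they do not depend on b. *)
definition circuit :: "'i set \<Rightarrow> 'j set \<Rightarrow> ('i \<Rightarrow> 'j \<Rightarrow> real) \<Rightarrow> ('j \<Rightarrow> real) \<Rightarrow> bool" where
  "circuit I J B g \<longleftrightarrow>
     g \<in> (J \<rightarrow>\<^sub>E UNIV) - {zero_vec J} \<and>
     coprime_integer_vec J g \<and>
     \<not> (\<exists>x \<in> (J \<rightarrow>\<^sub>E UNIV) - {zero_vec J}.
          supp I (mat_vec I J B x) \<subset> supp I (mat_vec I J B g))"

definition rank_rows :: "'a set \<Rightarrow> 'a set set" where
  "rank_rows V = Pow V - {{}}"

(* Constraint matrix of the system: sum x (induced_edges E U) \<le> |U| - 1 for all U in rank_rows V. *)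
definition rank_matrix :: "'a set set \<Rightarrow> 'a set \<Rightarrow> 'a set \<Rightarrow> real" where
  "rank_matrix E U e = (if e \<in> induced_edges E U then 1 else 0)"

lemma mat_vec_rank_matrix:
  assumes "finite_simple_graph V E" and "U \<in> rank_rows V"
  shows "mat_vec (rank_rows V) E (rank_matrix E) x U = (\<Sum>e\<in>induced_edges E U. x e)"
proof -
  have "E \<subseteq> Pow V" and "finite V"
    using assms(1) by (auto simp: finite_simple_graph_def)
  then have "finite E"
    using finite_subset by blast
  then have "(\<Sum>e\<in>E. rank_matrix E U e * x e) = (\<Sum>e\<in>induced_edges E U. x e)"
    by (intro sum.mono_neutral_cong_right) (auto simp: rank_matrix_def induced_edges_def)
  then show ?thesis
    using assms(2) by (simp add: mat_vec_def)
qed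

definition rank_circuit :: "'a set \<Rightarrow> 'a set set \<Rightarrow> ('a set \<Rightarrow> real) \<Rightarrow> bool" where
  "rank_circuit V E g \<longleftrightarrow> circuit (rank_rows V) E (rank_matrix E) g"

(* The list of edges traversed by a vertex sequence, in order. *)
definition walk_edges :: "'a list \<Rightarrow> 'a set list" where
  "walk_edges vs = map2 (\<lambda>u v. {u, v}) vs (tl vs)"

definition path_edge_list :: "'a set list \<Rightarrow> bool" where
  "path_edge_list es \<longleftrightarrow> (\<exists>vs. 2 \<le> length vs \<and> distinct vs \<and> es = walk_edges vs)"

definition cycle_edge_list :: "'a set list \<Rightarrow> bool" where
  "cycle_edge_list es \<longleftrightarrow>
     (\<exists>vs. 3 \<le> length vs \<and> distinct vs \<and> es = walk_edges (vs @ [hd vs]))"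

(* The list Hs holds the edge sequences of consecutive subpaths; Hs ! i is the subpath of index
   s + i. The offset s lets the first subpath of a path have either sign. *)
definition sign_blocks :: "('a set \<Rightarrow> real) \<Rightarrow> nat \<Rightarrow> 'a set list list \<Rightarrow> bool" where
  "sign_blocks g s Hs \<longleftrightarrow>
     (\<forall>i<length Hs. Hs ! i \<noteq> [] \<and>
        (\<forall>e\<in>set (Hs ! i). if even (s + i) then g e > 0 else g e < 0))"

definition pseudo_alternating_path ::
    "'a set set \<Rightarrow> ('a set \<Rightarrow> real) \<Rightarrow> nat \<Rightarrow> 'a set list list \<Rightarrow> bool" where
  "pseudo_alternating_path E g s Hs \<longleftrightarrow>
     path_edge_list (concat Hs) \<and> set (concat Hs) = supp E g \<and> sign_blocks g s Hs"

(* The traversal of the cycle starts where the first subpath starts. As the last subpath is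
   followed by the first one, signs alternate cyclically only for an even number of subpaths. *)
definition pseudo_alternating_cycle ::
    "'a set set \<Rightarrow> ('a set \<Rightarrow> real) \<Rightarrow> nat \<Rightarrow> 'a set list list \<Rightarrow> bool" where
  "pseudo_alternating_cycle E g s Hs \<longleftrightarrow>
     cycle_edge_list (concat Hs) \<and> set (concat Hs) = supp E g \<and> sign_blocks g s Hs \<and>
     even (length Hs)"

end

theory Submission imports Defs
begin

text \<open>
  The entries of \<open>g\<close> are coprime because \<open>1\<close> is among them. The substance is minimality: any \<open>x\<close>
  with \<open>supp (B x) \<subseteq> supp (B g)\<close> is a multiple of \<open>g\<close>, and a nonzero multiple has \<open>supp (B x) =
  supp (B g)\<close>, so a strict inclusion is impossible. Such an \<open>x\<close> satisfies every equation \<open>(B x)\<^sub>U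
  = 0\<close> that \<open>g\<close> satisfies. Taking for \<open>U\<close> the two ends of an edge outside the support of \<open>g\<close> shows
  that \<open>x\<close> vanishes there. Taking \<open>U = e \<union> f\<close>, where \<open>e\<close> and \<open>f\<close> are edges of opposite sign and
  the only support edges inside \<open>U\<close>, shows \<open>x e = - x f\<close>, that is \<open>x e * g e = x f * g f\<close>. So it
  suffices that the graph on the support edges whose links are these opposite pairs is connected
  (\<open>rank_circuitI\<close>).

  On a path or cycle, two edges of opposite sign whose positions differ by 1 or by at least 3 form
  such a pair; only at a difference of 2 does the union contain a third edge, the one in between.
  On a cycle the difference must be controlled in both directions. Since all subpaths have at
  least two edges, every edge of a subpath is linked to some edge of each neighbouring subpath.
  Hence connectedness follows as soon as one subpath lies in a single component
  (\<open>constant_on_blocks\<close>). On a path, this is the first subpath: all its edges are far from the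
  first edge of the fourth one, which has the opposite sign. On a cycle of four subpaths, the
  first and the fourth are neighbours, and this choice fails. There one takes a positive subpath
  and the last edge of the following negative one: as the latter has at least three edges, its
  last edge is linked to all of the positive subpath.

  Connectedness is expressed by saying that every function \<open>y\<close> that agrees on linked edges is
  constant; it is applied to the function that maps \<open>e\<close> to \<open>x e * g e\<close>.
\<close>

section \<open>Two-edge vertex sets and a criterion for circuits\<close>

definition induced_pair :: "'a set set \<Rightarrow> 'a set \<Rightarrow> 'a set \<Rightarrow> bool" where
  "induced_pair S e f \<longleftrightarrow> e \<noteq> f \<and> induced_edges S (e \<union> f) = {e, f}"

lemma finite_edges: "finite_simple_graph V E \<Longrightarrow> finite E"
  unfolding finite_simple_graph_def by (meson PowI finite_Pow_iff finite_subset subsetI)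

text \<open>The inclusion of supports, read contrapositively as implications between the equations
  \<open>(B g)\<^sub>U = 0\<close> and \<open>(B x)\<^sub>U = 0\<close>.\<close>
lemma rank_kernel_step:
  assumes G: "finite_simple_graph V E"
    and sub: "supp (rank_rows V) (mat_vec (rank_rows V) E (rank_matrix E) x)
      \<subseteq> supp (rank_rows V) (mat_vec (rank_rows V) E (rank_matrix E) g)"
    and U: "U \<subseteq> V" "U \<noteq> {}"
    and g0: "sum g (induced_edges E U) = 0"
  shows "sum x (induced_edges E U) = 0"
proof -
  have U': "U \<in> rank_rows V"
    using U by (auto simp: rank_rows_def)
  have "U \<notin> supp (rank_rows V) (mat_vec (rank_rows V) E (rank_matrix E) g)"
    using mat_vec_rank_matrix[OF G U'] g0 by (simp add: supp_def)
  then have "U \<notin> supp (rank_rows V) (mat_vec (rank_rows V) E (rank_matrix E) x)"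
    using sub by blast
  then show ?thesis
    using U' mat_vec_rank_matrix[OF G U'] by (simp add: supp_def)
qed

lemma induced_edges_edge:
  assumes "finite_simple_graph V E" "e \<in> E"
  shows "induced_edges E e = {e}"
proof -
  have "f = e" if "f \<in> E" "f \<subseteq> e" for f
  proof (rule card_subset_eq)
    show "finite e"
      using assms finite_subset by (auto simp: finite_simple_graph_def)
  qed (use assms that in \<open>auto simp: finite_simple_graph_def\<close>)
  then show ?thesis
    using assms(2) by (auto simp: induced_edges_def)
qed

text \<open>In a simple graph the two ends of an edge induce only that edge, so that single coordinates
  of \<open>B x\<close> recover single coordinates of \<open>x\<close>. This disposes of all chords of the path or cycle.\<close>
lemma rank_kernel_off_supp:
  assumes G: "finite_simple_graph V E"
    and sub: "supp (rank_rows V) (mat_vec (rank_rows V) E (rank_matrix E) x)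
      \<subseteq> supp (rank_rows V) (mat_vec (rank_rows V) E (rank_matrix E) g)"
    and e: "e \<in> E" "g e = 0"
  shows "x e = 0"
proof -
  have "e \<subseteq> V" "e \<noteq> {}"
    using G e(1) by (auto simp: finite_simple_graph_def)
  then show ?thesis
    using rank_kernel_step[OF G sub, of e] e induced_edges_edge[OF G e(1)] by simp
qed

text \<open>The set \<open>e \<union> f\<close> may also induce edges outside the support of \<open>g\<close>, but on these \<open>x\<close> vanishes.
  So the row of \<open>e \<union> f\<close> evaluates to \<open>g e + g f = 0\<close> at \<open>g\<close> and to \<open>x e + x f\<close> at \<open>x\<close>.\<close>
lemma rank_kernel_pair:
  assumes G: "finite_simple_graph V E"
    and sub: "supp (rank_rows V) (mat_vec (rank_rows V) E (rank_matrix E) x)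
      \<subseteq> supp (rank_rows V) (mat_vec (rank_rows V) E (rank_matrix E) g)"
    and ef: "e \<in> E" "f \<in> E" "induced_pair (supp E g) e f" "g e = - g f"
  shows "x e = - x f"
proof -
  let ?U = "e \<union> f"
  have U: "?U \<subseteq> V" "?U \<noteq> {}"
    using G ef(1,2) by (auto simp: finite_simple_graph_def)
  have pair: "e \<noteq> f" "induced_edges (supp E g) ?U = {e, f}"
    using ef(3) by (auto simp: induced_pair_def)
  have sum_pair: "sum z (induced_edges E ?U) = z e + z f"
    if z: "\<forall>h\<in>E. g h = 0 \<longrightarrow> z h = 0" for z :: "'a set \<Rightarrow> real"
  proof -
    have "sum z (induced_edges E ?U) = sum z (induced_edges (supp E g) ?U)"
      using finite_edges[OF G] z
      by (intro sum.mono_neutral_right) (auto simp: induced_edges_def supp_def)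
    then show ?thesis
      using pair by simp
  qed
  have "sum g (induced_edges E ?U) = 0"
    using sum_pair[of g] ef(4) by simp
  then have "sum x (induced_edges E ?U) = 0"
    by (rule rank_kernel_step[OF G sub U])
  then show ?thesis
    using sum_pair[of x] rank_kernel_off_supp[OF G sub] by auto
qed

text \<open>As the nonzero values of \<open>g\<close> are \<open>1\<close> and \<open>-1\<close>, the ratio of \<open>x\<close> to \<open>g\<close> on the support is
  \<open>x e * g e\<close>, and opposite induced pairs preserve it. If they connect the support, the ratio is a
  constant \<open>c\<close>, and \<open>x = c * g\<close>.\<close>
lemma rank_circuitI:
  assumes G: "finite_simple_graph V E"
    and g: "g \<in> E \<rightarrow>\<^sub>E {0, 1, -1}"
    and mixed: "mixed_sign E g"
    and connected: "\<And>y :: 'a set \<Rightarrow> real.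
      (\<And>e f. e \<in> supp E g \<Longrightarrow> f \<in> supp E g \<Longrightarrow> g e = - g f \<Longrightarrow> induced_pair (supp E g) e f
        \<Longrightarrow> y e = y f) \<Longrightarrow> \<exists>c. \<forall>e\<in>supp E g. y e = c"
  shows "rank_circuit V E g"
proof -
  have entries: "g e \<in> {0, 1, -1}" if "e \<in> E" for e
    using g that by auto
  have squares: "g e * g e = 1" if "e \<in> supp E g" for e
    using that entries[of e] by (auto simp: supp_def)
  have nonzero: "g \<in> (E \<rightarrow>\<^sub>E UNIV) - {zero_vec E}"
    using g mixed by (auto simp: mixed_sign_def zero_vec_def PiE_iff)
  have "coprime_integer_vec E g"
    unfolding coprime_integer_vec_def
  proof (intro exI conjI ballI)
    show "g e = of_int \<lfloor>g e\<rfloor>" if "e \<in> E" for e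
      using entries[OF that] by auto
    obtain e where e: "e \<in> E" "g e > 0"
      using mixed by (auto simp: mixed_sign_def)
    then have "g e = 1"
      using entries[of e] by auto
    then have "Gcd ((\<lambda>e. \<lfloor>g e\<rfloor>) ` E) dvd 1"
      by (intro Gcd_dvd) (use e(1) in force)
    then show "Gcd ((\<lambda>e. \<lfloor>g e\<rfloor>) ` E) = 1"
      by simp
  qed
  moreover have "\<not> supp (rank_rows V) (mat_vec (rank_rows V) E (rank_matrix E) x)
      \<subset> supp (rank_rows V) (mat_vec (rank_rows V) E (rank_matrix E) g)"
    if x: "x \<in> (E \<rightarrow>\<^sub>E UNIV) - {zero_vec E}" for x
  proof
    assume "supp (rank_rows V) (mat_vec (rank_rows V) E (rank_matrix E) x)
      \<subset> supp (rank_rows V) (mat_vec (rank_rows V) E (rank_matrix E) g)"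
    then have sub: "supp (rank_rows V) (mat_vec (rank_rows V) E (rank_matrix E) x)
        \<subseteq> supp (rank_rows V) (mat_vec (rank_rows V) E (rank_matrix E) g)"
      and neq: "supp (rank_rows V) (mat_vec (rank_rows V) E (rank_matrix E) x)
        \<noteq> supp (rank_rows V) (mat_vec (rank_rows V) E (rank_matrix E) g)"
      by auto
    have "x e * g e = x f * g f"
      if "e \<in> supp E g" "f \<in> supp E g" "g e = - g f" "induced_pair (supp E g) e f" for e f
      using rank_kernel_pair[OF G sub, of e f] that by (simp add: supp_def)
    then obtain c where c: "x e * g e = c" if "e \<in> supp E g" for e
      using connected[of "\<lambda>e. x e * g e"] by blast
    have multiple: "x e = c * g e" if e: "e \<in> E" for e
    proof (cases "g e = 0")
      case True
      then show ?thesis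
        using rank_kernel_off_supp[OF G sub e] by simp
    next
      case False
      then have "e \<in> supp E g"
        using e by (simp add: supp_def)
      then show ?thesis
        using c[of e] squares[of e] by (metis mult.assoc mult.right_neutral)
    qed
    have "c \<noteq> 0"
    proof
      assume "c = 0"
      then have "x = zero_vec E"
        using x multiple by (auto simp: zero_vec_def PiE_iff extensional_def fun_eq_iff)
      then show False
        using x by simp
    qed
    moreover have "mat_vec (rank_rows V) E (rank_matrix E) x U
        = c * mat_vec (rank_rows V) E (rank_matrix E) g U" if "U \<in> rank_rows V" for U
      using that multiple by (simp add: mat_vec_def sum_distrib_left algebra_simps)
    ultimately have "supp (rank_rows V) (mat_vec (rank_rows V) E (rank_matrix E) x)
        = supp (rank_rows V) (mat_vec (rank_rows V) E (rank_matrix E) g)"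
      by (auto simp: supp_def)
    with neq show False ..
  qed
  ultimately show ?thesis
    using nonzero unfolding rank_circuit_def circuit_def by blast
qed

section \<open>Induced pairs on paths and cycles\<close>

lemma length_walk_edges: "length (walk_edges vs) = length vs - 1"
  by (simp add: walk_edges_def)

lemma walk_edges_nth:
  "Suc i < length vs \<Longrightarrow> walk_edges vs ! i = {vs ! i, vs ! Suc i}"
  by (simp add: walk_edges_def nth_tl)

lemma induced_pairI_nth:
  assumes "p < length es" "q < length es" "es ! p \<noteq> es ! q"
    and "\<And>k. k < length es \<Longrightarrow> es ! k \<subseteq> es ! p \<union> es ! q \<Longrightarrow> k = p \<or> k = q"
  shows "induced_pair (set es) (es ! p) (es ! q)"
  unfolding induced_pair_def induced_edges_def
  using assms by (auto simp: in_set_conv_nth)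

text \<open>A third edge of the path inside \<open>es ! p \<union> es ! q\<close> would have to join an end of the first edge to
  an end of the second one without being either of them, which happens only for \<open>q = p + 2\<close>.\<close>
lemma path_induced_pair:
  assumes path: "path_edge_list es"
    and pq: "p < q" "q < length es" "q = Suc p \<or> p + 3 \<le> q"
  shows "induced_pair (set es) (es ! p) (es ! q)"
proof -
  obtain vs where vs: "distinct vs" "es = walk_edges vs"
    using path by (auto simp: path_edge_list_def)
  have es_nth: "es ! i = {vs ! i, vs ! Suc i}" if "i < length es" for i
    using that vs(2) by (simp add: length_walk_edges walk_edges_nth)
  have eq: "vs ! i = vs ! j \<longleftrightarrow> i = j" if "i \<le> length es" "j \<le> length es" for i j
    using that vs pq(2) by (intro nth_eq_iff_index_eq) (auto simp: length_walk_edges)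
  show ?thesis
  proof (rule induced_pairI_nth)
    show "es ! p \<noteq> es ! q"
      using pq by (auto simp: es_nth doubleton_eq_iff eq)
    show "k = p \<or> k = q" if "k < length es" "es ! k \<subseteq> es ! p \<union> es ! q" for k
      using that pq by (auto simp: es_nth eq)
  qed (use pq in auto)
qed

text \<open>The condition \<open>q + 3 \<le> p + length es\<close> bounds the distance of the two edges along the other arc of
  the cycle. For adjacent edges that arc only has to miss being a single edge, hence the cycle must
  not be a triangle.\<close>
lemma cycle_induced_pair:
  assumes cycle: "cycle_edge_list es" and n: "4 \<le> length es"
    and pq: "p < q" "q < length es" "q = Suc p \<or> p + 3 \<le> q \<and> q + 3 \<le> p + length es"
  shows "induced_pair (set es) (es ! p) (es ! q)"
proof -
  obtain vs where "3 \<le> length vs" and vs: "distinct vs" "es = walk_edges (vs @ [hd vs])"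
    using cycle by (auto simp: cycle_edge_list_def)
  then have "vs \<noteq> []"
    by auto
  have len: "length es = length vs"
    using vs(2) by (simp add: length_walk_edges)
  define nxt where "nxt i = (if Suc i = length es then 0 else Suc i)" for i
  have nxt_less: "nxt i < length es" if "i < length es" for i
    using that by (auto simp: nxt_def)
  have es_nth: "es ! i = {vs ! i, vs ! nxt i}" if "i < length es" for i
    using that vs(2) len \<open>vs \<noteq> []\<close>
    by (auto simp: walk_edges_nth nth_append nxt_def hd_conv_nth)
  have eq: "vs ! i = vs ! j \<longleftrightarrow> i = j" if "i < length es" "j < length es" for i j
    using that vs(1) len by (intro nth_eq_iff_index_eq) auto
  show ?thesis
  proof (rule induced_pairI_nth)
    show "es ! p \<noteq> es ! q"
      using pq n nxt_less[of p] nxt_less[of q]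
      by (auto simp: es_nth doubleton_eq_iff eq nxt_def split: if_splits)
    fix k
    assume k: "k < length es" "es ! k \<subseteq> es ! p \<union> es ! q"
    then have "k \<in> {p, nxt p, q, nxt q}" "nxt k \<in> {p, nxt p, q, nxt q}"
      using pq nxt_less[of k] nxt_less[of p] nxt_less[of q] by (auto simp: es_nth eq)
    then show "k = p \<or> k = q"
      using pq n k(1) unfolding nxt_def by (auto split: if_splits)
  qed (use pq in auto)
qed

section \<open>Propagation along blocks\<close>

definition offset :: "'b list list \<Rightarrow> nat \<Rightarrow> nat" where
  "offset Hs k = length (concat (take k Hs))"

lemma offset_0 [simp]: "offset Hs 0 = 0"
  by (simp add: offset_def)

lemma offset_Suc: "k < length Hs \<Longrightarrow> offset Hs (Suc k) = offset Hs k + length (Hs ! k)"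
  by (simp add: offset_def take_Suc_conv_app_nth)

lemma offset_length: "offset Hs (length Hs) = length (concat Hs)"
  by (simp add: offset_def)

lemma concat_nth_offset:
  assumes "k < length Hs" "j < length (Hs ! k)"
  shows "concat Hs ! (offset Hs k + j) = Hs ! k ! j"
proof -
  have "concat Hs = concat (take k Hs) @ Hs ! k @ concat (drop (Suc k) Hs)"
    using arg_cong[OF id_take_nth_drop[OF assms(1)], of concat] by simp
  then show ?thesis
    using assms(2) by (simp add: offset_def nth_append)
qed

lemma offset_mono:
  assumes "\<forall>i<length Hs. 2 \<le> length (Hs ! i)" "i \<le> j" "j \<le> length Hs"
  shows "offset Hs i + 2 * (j - i) \<le> offset Hs j"
  using assms(2,3)
proof (induction j rule: dec_induct)
  case (step j)
  then have "2 \<le> length (Hs ! j)"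
    using assms(1) by simp
  with step show ?case
    by (simp add: offset_Suc Suc_diff_le)
qed simp

text \<open>Outside two consecutive blocks there are at least two further blocks, hence at least four edges,
  so edges of consecutive blocks are never close to each other around the other arc of a cycle.
  Propagation therefore needs no separate treatment of cycles.\<close>
lemma consecutive_blocks_wrap:
  assumes two: "\<forall>i<length Hs. 2 \<le> length (Hs ! i)" and four: "4 \<le> length Hs"
    and k: "Suc k < length Hs"
    and pq: "offset Hs k \<le> p" "q < offset Hs (Suc (Suc k))"
  shows "q + 3 \<le> p + length (concat Hs)"
proof -
  have "offset Hs 0 + 2 * k \<le> offset Hs k"
    "offset Hs (Suc (Suc k)) + 2 * (length Hs - Suc (Suc k)) \<le> length (concat Hs)"
    using offset_mono[OF two, of 0 k] offset_mono[OF two, of "Suc (Suc k)" "length Hs"] k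
    by (auto simp: offset_length)
  with pq k four show ?thesis
    by (cases "k = 0") auto
qed

text \<open>By the hypothesis \<open>link\<close>, \<open>y\<close> takes each of its values on a block also on the next block and, by
  the mirror image of the same argument, on the previous one. So a constant value on
  one block spreads in both directions.\<close>
lemma constant_on_blocks:
  fixes y :: "'b \<Rightarrow> 'c"
  assumes two: "\<forall>i<length Hs. 2 \<le> length (Hs ! i)" and four: "4 \<le> length Hs"
    and link: "\<And>i p q. Suc i < length Hs \<Longrightarrow> offset Hs i \<le> p \<Longrightarrow> p < offset Hs (Suc i) \<Longrightarrow>
      offset Hs (Suc i) \<le> q \<Longrightarrow> q < offset Hs (Suc (Suc i)) \<Longrightarrow> q = Suc p \<or> p + 3 \<le> q \<Longrightarrow>
      y (concat Hs ! p) = y (concat Hs ! q)"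
    and seed: "k < length Hs"
      "\<And>p. offset Hs k \<le> p \<Longrightarrow> p < offset Hs (Suc k) \<Longrightarrow> y (concat Hs ! p) = c"
  shows "\<forall>e\<in>set (concat Hs). y e = c"
proof -
  have link': "y (Hs ! i ! a) = y (Hs ! Suc i ! b)"
    if i: "Suc i < length Hs" and ab: "a < length (Hs ! i)" "b < length (Hs ! Suc i)"
      and near: "Suc a = length (Hs ! i) \<and> b = 0 \<or> a + 3 \<le> length (Hs ! i) + b" for i a b
  proof -
    have "y (concat Hs ! (offset Hs i + a)) = y (concat Hs ! (offset Hs (Suc i) + b))"
      by (rule link[OF i]) (use i ab near in \<open>auto simp: offset_Suc\<close>)
    then show ?thesis
      using i ab by (simp add: concat_nth_offset)
  qed
  define const where "const i \<longleftrightarrow> (\<forall>j<length (Hs ! i). y (Hs ! i ! j) = c)" for i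
  have up: "const (Suc i)" if i: "Suc i < length Hs" "const i" for i
    unfolding const_def
  proof (intro allI impI)
    fix b
    assume b: "b < length (Hs ! Suc i)"
    have "2 \<le> length (Hs ! i)"
      using two i by auto
    \<comment> \<open>The first edge of a block is adjacent to the last edge of the previous block; any other
      edge is at distance at least 3 from the first edge of that block.\<close>
    define a where "a = (if b = 0 then length (Hs ! i) - 1 else 0)"
    have "a < length (Hs ! i)"
      using \<open>2 \<le> length (Hs ! i)\<close> by (auto simp: a_def)
    have "y (Hs ! i ! a) = y (Hs ! Suc i ! b)"
      by (rule link') (use i b \<open>2 \<le> length (Hs ! i)\<close> in \<open>auto simp: a_def\<close>)
    moreover have "y (Hs ! i ! a) = c"
      using i(2) \<open>a < length (Hs ! i)\<close> by (simp add: const_def)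
    ultimately show "y (Hs ! Suc i ! b) = c"
      by simp
  qed
  have down: "const i" if i: "Suc i < length Hs" "const (Suc i)" for i
    unfolding const_def
  proof (intro allI impI)
    fix a
    assume a: "a < length (Hs ! i)"
    have "2 \<le> length (Hs ! Suc i)"
      using two i by auto
    define b where "b = (if Suc a = length (Hs ! i) then 0 else length (Hs ! Suc i) - 1)"
    have "b < length (Hs ! Suc i)"
      using \<open>2 \<le> length (Hs ! Suc i)\<close> by (auto simp: b_def)
    have "y (Hs ! i ! a) = y (Hs ! Suc i ! b)"
      by (rule link') (use i a \<open>2 \<le> length (Hs ! Suc i)\<close> in \<open>auto simp: b_def\<close>)
    moreover have "y (Hs ! Suc i ! b) = c"
      using i(2) \<open>b < length (Hs ! Suc i)\<close> by (simp add: const_def)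
    ultimately show "y (Hs ! i ! a) = c"
      by simp
  qed
  have "const k"
    unfolding const_def
  proof (intro allI impI)
    fix j
    assume "j < length (Hs ! k)"
    then show "y (Hs ! k ! j) = c"
      using seed(2)[of "offset Hs k + j"] seed(1) by (simp add: offset_Suc concat_nth_offset)
  qed
  have "const i" if "i < length Hs" for i
  proof (cases "k \<le> i")
    case True
    then show ?thesis
      using that by (induction i rule: dec_induct) (auto intro: up \<open>const k\<close>)
  next
    case False
    then have "i \<le> k"
      by simp
    then show ?thesis
      using seed(1) by (induction i rule: inc_induct) (auto intro: down \<open>const k\<close>)
  qed
  then show ?thesis
    by (auto simp: const_def in_set_conv_nth)
qed

section \<open>Pseudo-alternating paths and cycles\<close>

text \<open>Position form of the sign condition: edges in blocks whose indices differ in parity have opposite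
  values, not only opposite signs.\<close>
lemma sign_blocks_nth:
  assumes g: "g \<in> E \<rightarrow>\<^sub>E {0, 1, -1}" and S: "set (concat Hs) = supp E g"
    and sign: "sign_blocks g s Hs"
    and i: "i < length Hs" and p: "offset Hs i \<le> p" "p < offset Hs (Suc i)"
  shows "g (concat Hs ! p) = (if even (s + i) then 1 else -1)"
proof -
  obtain j where j: "p = offset Hs i + j" "j < length (Hs ! i)"
    using p i by (auto simp: offset_Suc dest: le_Suc_ex)
  define e where "e = Hs ! i ! j"
  have e: "e \<in> set (Hs ! i)"
    using j(2) by (simp add: e_def)
  then have "e \<in> set (concat Hs)"
    using i by auto
  then have "e \<in> E"
    unfolding S by (simp add: supp_def)
  then have "g e \<in> {0, 1, -1}"
    using g by auto
  moreover have "if even (s + i) then g e > 0 else g e < 0"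
    using sign i e unfolding sign_blocks_def by blast
  ultimately show ?thesis
    using concat_nth_offset[OF i j(2)] by (auto simp: j(1) e_def split: if_splits)
qed

text \<open>The seed is the first block. All its edges are linked to the first edge of the fourth block: the
  signs differ, and the second and third blocks put at least four edges in between.\<close>
lemma pseudo_alternating_path_constant:
  fixes y :: "'a set \<Rightarrow> 'c"
  assumes g: "g \<in> E \<rightarrow>\<^sub>E {0, 1, -1}"
    and path: "pseudo_alternating_path E g s Hs"
    and four: "4 \<le> length Hs" and two: "\<forall>i<length Hs. 2 \<le> length (Hs ! i)"
    and y: "\<And>e f. e \<in> supp E g \<Longrightarrow> f \<in> supp E g \<Longrightarrow> g e = - g f \<Longrightarrow>
      induced_pair (supp E g) e f \<Longrightarrow> y e = y f"
  shows "\<exists>c. \<forall>e\<in>supp E g. y e = c"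
proof -
  let ?es = "concat Hs"
  have path': "path_edge_list ?es" and S: "set ?es = supp E g" and sign: "sign_blocks g s Hs"
    using path by (auto simp: pseudo_alternating_path_def)
  note sgn = sign_blocks_nth[OF g S sign]
  have link: "y (?es ! p) = y (?es ! q)"
    if ij: "i < j" "j < length Hs" "even i \<noteq> even j"
      and p: "offset Hs i \<le> p" "p < offset Hs (Suc i)"
      and q: "offset Hs j \<le> q" "q < offset Hs (Suc j)"
      and near: "q = Suc p \<or> p + 3 \<le> q" for i j p q
  proof (rule y)
    have "p < q" "q < length ?es"
      using near q(2) offset_mono[OF two, of "Suc j" "length Hs"] ij by (auto simp: offset_length)
    then show "induced_pair (supp E g) (?es ! p) (?es ! q)"
      and "?es ! p \<in> supp E g" "?es ! q \<in> supp E g"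
      using path_induced_pair[OF path', of p q] near by (auto simp: S[symmetric] simp del: set_concat)
    show "g (?es ! p) = - g (?es ! q)"
      using sgn[OF _ p] sgn[OF _ q] ij by auto
  qed
  have "\<forall>e\<in>set ?es. y e = y (?es ! offset Hs 3)"
  proof (rule constant_on_blocks[OF two four])
    show "0 < length Hs"
      using four by linarith
    show "y (?es ! p) = y (?es ! q)"
      if "Suc i < length Hs" "offset Hs i \<le> p" "p < offset Hs (Suc i)"
        "offset Hs (Suc i) \<le> q" "q < offset Hs (Suc (Suc i))" "q = Suc p \<or> p + 3 \<le> q" for i p q
      using that by (intro link[of i "Suc i"]) auto
    fix p
    assume p: "offset Hs 0 \<le> p" "p < offset Hs (Suc 0)"
    show "y (?es ! p) = y (?es ! offset Hs 3)"
      using offset_mono[OF two, of "Suc 0" 3] offset_mono[OF two, of 3 4] four p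
      by (intro link[of 0 3]) auto
  qed
  then show ?thesis
    unfolding S by blast
qed

text \<open>The seed is a positive block that is followed by a negative block within the list. The last edge of
  the negative block is linked to every edge of the positive one: it is at least three positions
  ahead because the negative block has at least three edges, and \<open>consecutive_blocks_wrap\<close> bounds
  the distance along the other arc.\<close>
lemma pseudo_alternating_cycle_constant:
  fixes y :: "'a set \<Rightarrow> 'c"
  assumes g: "g \<in> E \<rightarrow>\<^sub>E {0, 1, -1}"
    and cycle: "pseudo_alternating_cycle E g s Hs"
    and four: "4 \<le> length Hs"
    and len: "\<forall>i<length Hs. if even (s + i) then 2 \<le> length (Hs ! i) else 3 \<le> length (Hs ! i)"
    and y: "\<And>e f. e \<in> supp E g \<Longrightarrow> f \<in> supp E g \<Longrightarrow> g e = - g f \<Longrightarrow>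
      induced_pair (supp E g) e f \<Longrightarrow> y e = y f"
  shows "\<exists>c. \<forall>e\<in>supp E g. y e = c"
proof -
  let ?es = "concat Hs"
  have two: "\<forall>i<length Hs. 2 \<le> length (Hs ! i)"
    using len by (metis One_nat_def Suc_1 Suc_leD numeral_3_eq_3)
  have cycle': "cycle_edge_list ?es" and S: "set ?es = supp E g" and sign: "sign_blocks g s Hs"
    using cycle by (auto simp: pseudo_alternating_cycle_def)
  note sgn = sign_blocks_nth[OF g S sign]
  have long: "4 \<le> length ?es"
    using offset_mono[OF two, of 0 "length Hs"] four by (simp add: offset_length)
  have link: "y (?es ! p) = y (?es ! q)"
    if i: "Suc i < length Hs"
      and p: "offset Hs i \<le> p" "p < offset Hs (Suc i)"
      and q: "offset Hs (Suc i) \<le> q" "q < offset Hs (Suc (Suc i))"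
      and near: "q = Suc p \<or> p + 3 \<le> q" for i p q
  proof (rule y)
    have "p < q" "q < length ?es"
      using near q(2) offset_mono[OF two, of "Suc (Suc i)" "length Hs"] i
      by (auto simp: offset_length)
    then show "induced_pair (supp E g) (?es ! p) (?es ! q)"
      and "?es ! p \<in> supp E g" "?es ! q \<in> supp E g"
      using cycle_induced_pair[OF cycle' long, of p q] near
        consecutive_blocks_wrap[OF two four i p(1) q(2)]
      by (auto simp: S[symmetric] simp del: set_concat)
    show "g (?es ! p) = - g (?es ! q)"
      using sgn[OF _ p] sgn[OF i q] i by auto
  qed
  \<comment> \<open>The first block of even index, hence positive; one of the first two, so a successor exists.\<close>
  define k where "k = s mod 2"
  have k: "Suc k < length Hs" "odd (s + Suc k)"
    using four by (auto simp: k_def)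
  have three: "3 \<le> length (Hs ! Suc k)"
    using len k by auto
  have last: "offset Hs (Suc (Suc k)) = offset Hs (Suc k) + length (Hs ! Suc k)"
    using k by (simp add: offset_Suc)
  have "\<forall>e\<in>set ?es. y e = y (?es ! (offset Hs (Suc (Suc k)) - 1))"
  proof (rule constant_on_blocks[OF two four])
    show "k < length Hs"
      using k by simp
    show "y (?es ! p) = y (?es ! (offset Hs (Suc (Suc k)) - 1))"
      if "offset Hs k \<le> p" "p < offset Hs (Suc k)" for p
      using that three last k by (intro link[of k]) auto
  qed (rule link)
  then show ?thesis
    unfolding S by blast
qed

theorem lemma4p7:
  fixes V :: "'a set" and E :: "'a set set" and g :: "'a set \<Rightarrow> real"
  assumes "finite_simple_graph V E"
    and "g \<in> E \<rightarrow>\<^sub>E {0, 1, -1}"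
    and "mixed_sign E g"
    and "(\<exists>s Hs. pseudo_alternating_path E g s Hs \<and> 4 \<le> length Hs \<and>
            (\<forall>i<length Hs. 2 \<le> length (Hs ! i)))
       \<or> (\<exists>s Hs. pseudo_alternating_cycle E g s Hs \<and> 4 \<le> length Hs \<and>
            (\<forall>i<length Hs. if even (s + i) then 2 \<le> length (Hs ! i) else 3 \<le> length (Hs ! i)))"
  shows "rank_circuit V E g"
proof (rule rank_circuitI[OF assms(1-3)])
  fix y :: "'a set \<Rightarrow> real"
  assume y: "\<And>e f. e \<in> supp E g \<Longrightarrow> f \<in> supp E g \<Longrightarrow> g e = - g f \<Longrightarrow>
    induced_pair (supp E g) e f \<Longrightarrow> y e = y f"
  from assms(4) show "\<exists>c. \<forall>e\<in>supp E g. y e = c"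
  proof (elim disjE exE conjE)
    fix s Hs
    assume "pseudo_alternating_path E g s Hs" "4 \<le> length Hs"
      "\<forall>i<length Hs. 2 \<le> length (Hs ! i)"
    then show ?thesis
      by (rule pseudo_alternating_path_constant[OF assms(2)]) (rule y)
  next
    fix s Hs
    assume "pseudo_alternating_cycle E g s Hs" "4 \<le> length Hs"
      "\<forall>i<length Hs. if even (s + i) then 2 \<le> length (Hs ! i) else 3 \<le> length (Hs ! i)"
    then show ?thesis
      by (rule pseudo_alternating_cycle_constant[OF assms(2)]) (rule y)
  qed
qed

end
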